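(* Let $I\subseteq\mathbb{R}$ be a bounded interval and let $f:I\times I\to\mathbb{R}$ be a factorable double function. Then $f$ is uniformly continuous on $I\times I$ if and only if for every Cauchy double sequence $\{z_{k,l}\}$ of points of $I\times I$ the image double sequence $\{f(z_{k,l})\}$ is quasi-Cauchy.
   Context: A function $f:I\times I\to\mathbb{R}$ is called factorable if there are functions $g,h:I\to\mathbb{R}$ with $f(x,y)=g(x)h(y)$ for all $x,y\in I$. A double sequence is a family indexed by $(k,l)\in\mathbb{N}\times\mathbb{N}$, where $\mathbb{N}=\{1,2,3,\dots\}$. Below, $|\cdot|$ is the absolute value on $\mathbb{R}$ or the Euclidean norm on $\mathbb{R}^2$. A double sequence $\{z_{k,l}\}$ in $\mathbb{R}$ or $\mathbb{R}^2$ is Cauchy if for every $\epsilon>0$ there is $N\in\mathbb{N}$ such that $|z_{k,l}-z_{s,t}|<\epsilon$ whenever $k,l,s,t>N$. It is quasi-Cauchy if for every $\epsilon>0$ there is $N\in\mathbb{N}$ such that $\max_{r,s\in\{0,1\}}|z_{k,l}-z_{k+r,l+s}|<\epsilon$ whenever $k,l>N$. Uniform continuity is with respect to the Euclidean metric on $I\times I\subseteq\mathbb{R}^2$. *)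

theory Defs
  imports "HOL-Analysis.Analysis"
begin

definition factorable_on :: "real set \<Rightarrow> (real \<times> real \<Rightarrow> real) \<Rightarrow> bool" where
  "factorable_on I f \<longleftrightarrow>
     (\<exists>g h :: real \<Rightarrow> real. \<forall>x\<in>I. \<forall>y\<in>I. f (x, y) = g x * h y)"

text \<open>Double sequences are indexed by pairs of positive integers. They are represented by
  functions on \<^typ>\<open>nat\<close>, whose values at index 0 never matter. The norm on
  \<^typ>\<open>real \<times> real\<close> is the Euclidean one.\<close>

definition double_seq_in :: "'a set \<Rightarrow> (nat \<Rightarrow> nat \<Rightarrow> 'a) \<Rightarrow> bool" where
  "double_seq_in S z \<longleftrightarrow> (\<forall>k\<ge>1. \<forall>l\<ge>1. z k l \<in> S)"

definition double_Cauchy :: "(nat \<Rightarrow> nat \<Rightarrow> 'a::real_normed_vector) \<Rightarrow> bool" where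
  "double_Cauchy z \<longleftrightarrow>
     (\<forall>\<epsilon>>0. \<exists>N\<ge>1. \<forall>k>N. \<forall>l>N. \<forall>s>N. \<forall>t>N. norm (z k l - z s t) < \<epsilon>)"

definition double_quasi_Cauchy :: "(nat \<Rightarrow> nat \<Rightarrow> 'a::real_normed_vector) \<Rightarrow> bool" where
  "double_quasi_Cauchy z \<longleftrightarrow>
     (\<forall>\<epsilon>>0. \<exists>N\<ge>1. \<forall>k>N. \<forall>l>N.
        (MAX (r, s)\<in>{0, 1} \<times> {0, 1}. norm (z k l - z (k + r) (l + s))) < \<epsilon>)"

end

theory Submission
  imports Defs
begin

text \<open>The equivalence expresses two facts. A uniformly continuous function maps Cauchy double
  sequences to Cauchy ones, and the defining inequality of a Cauchy double sequence contains that of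
  a quasi-Cauchy one. Conversely, if \<open>f\<close> is not uniformly continuous, there are points \<open>a n\<close>, \<open>b n\<close>
  of the domain whose distance tends to 0 while their images stay at least \<open>\<epsilon>\<close> apart.
  The domain is bounded, so along a subsequence both converge to one common point (which need not lie
  in the domain). The interleaving \<open>a 0, b 0, a 1, b 1, \<dots>\<close> then converges too, and, read as a
  double sequence that is constant in its second index, it is Cauchy. But its images jump by at
  least \<open>\<epsilon>\<close> from each even first index to the next, so they are not quasi-Cauchy.\<close>

lemma double_quasi_Cauchy_iff:
  "double_quasi_Cauchy z \<longleftrightarrow>
     (\<forall>\<epsilon>>0. \<exists>N\<ge>1. \<forall>k>N. \<forall>l>N. \<forall>r\<in>{0,1}. \<forall>s\<in>{0,1}.
        norm (z k l - z (k + r) (l + s)) < \<epsilon>)"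
proof -
  have "(MAX (r, s)\<in>{0, 1} \<times> {0, 1}. norm (z k l - z (k + r) (l + s))) < \<epsilon> \<longleftrightarrow>
      (\<forall>r\<in>{0,1}. \<forall>s\<in>{0,1}. norm (z k l - z (k + r) (l + s)) < \<epsilon>)" for k l \<epsilon>
    by (subst Max_less_iff) auto
  then show ?thesis
    unfolding double_quasi_Cauchy_def by simp
qed

lemma double_Cauchy_imp_quasi_Cauchy:
  assumes "double_Cauchy z"
  shows "double_quasi_Cauchy z"
  unfolding double_quasi_Cauchy_iff
proof (intro allI impI)
  fix \<epsilon> :: real
  assume "\<epsilon> > 0"
  with assms obtain N where "N \<ge> 1"
    and N: "\<And>k l s t. k > N \<Longrightarrow> l > N \<Longrightarrow> s > N \<Longrightarrow> t > N \<Longrightarrow> norm (z k l - z s t) < \<epsilon>"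
    unfolding double_Cauchy_def by meson
  then show "\<exists>N\<ge>1. \<forall>k>N. \<forall>l>N. \<forall>r\<in>{0,1}. \<forall>s\<in>{0,1}.
      norm (z k l - z (k + r) (l + s)) < \<epsilon>"
    by (intro exI[of _ N] conjI allI impI ballI) (auto intro!: N)
qed

lemma uniformly_continuous_on_double_Cauchy:
  fixes f :: "'a::real_normed_vector \<Rightarrow> 'b::real_normed_vector"
  assumes "uniformly_continuous_on S f" and S: "double_seq_in S z" and "double_Cauchy z"
  shows "double_Cauchy (\<lambda>k l. f (z k l))"
  unfolding double_Cauchy_def
proof (intro allI impI)
  fix \<epsilon> :: real
  assume "\<epsilon> > 0"
  with assms(1) obtain d where "d > 0"
    and d: "\<And>x y. x \<in> S \<Longrightarrow> y \<in> S \<Longrightarrow> dist x y < d \<Longrightarrow> dist (f x) (f y) < \<epsilon>"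
    unfolding uniformly_continuous_on_def by meson
  from assms(3) \<open>d > 0\<close> obtain N where "N \<ge> 1"
    and N: "\<And>k l s t. k > N \<Longrightarrow> l > N \<Longrightarrow> s > N \<Longrightarrow> t > N \<Longrightarrow> norm (z k l - z s t) < d"
    unfolding double_Cauchy_def by meson
  have "norm (f (z k l) - f (z s t)) < \<epsilon>" if "k > N" "l > N" "s > N" "t > N" for k l s t
  proof -
    have "z k l \<in> S" "z s t \<in> S"
      using S \<open>N \<ge> 1\<close> that unfolding double_seq_in_def by auto
    then show ?thesis
      using d N[OF that] by (simp add: dist_norm)
  qed
  with \<open>N \<ge> 1\<close> show "\<exists>N\<ge>1. \<forall>k>N. \<forall>l>N. \<forall>s>N. \<forall>t>N. norm (f (z k l) - f (z s t)) < \<epsilon>"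
    by blast
qed

lemma Cauchy_imp_double_Cauchy:
  fixes w :: "nat \<Rightarrow> 'a::real_normed_vector"
  assumes "Cauchy w"
  shows "double_Cauchy (\<lambda>k l. w k)"
  unfolding double_Cauchy_def
proof (intro allI impI)
  fix \<epsilon> :: real
  assume "\<epsilon> > 0"
  with assms obtain M where "\<And>k s. k \<ge> M \<Longrightarrow> s \<ge> M \<Longrightarrow> norm (w k - w s) < \<epsilon>"
    unfolding Cauchy_iff by meson
  then show "\<exists>N\<ge>1. \<forall>k>N. \<forall>l>N. \<forall>s>N. \<forall>t>N. norm (w k - w s) < \<epsilon>"
    by (intro exI[of _ "max 1 M"]) auto
qed

lemma LIMSEQ_interleave:
  assumes "a \<longlonglongrightarrow> p" and "b \<longlonglongrightarrow> p"
  shows "(\<lambda>n. if even n then a (n div 2) else b (n div 2)) \<longlonglongrightarrow> p"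
proof -
  have half: "filterlim (\<lambda>n::nat. n div 2) sequentially sequentially"
    by (rule filterlim_at_top_div_const_nat) simp
  show ?thesis
    by (intro filterlim_If tendsto_mono[OF _ filterlim_compose[OF assms(1) half]]
          tendsto_mono[OF _ filterlim_compose[OF assms(2) half]]) auto
qed

text \<open>Boundedness supplies what the negation of uniform continuity leaves open: the two sequences,
  which only get close to each other, can be made to converge.\<close>

lemma not_uniformly_continuous_on_bounded:
  fixes f :: "'a::heine_borel \<Rightarrow> 'b::metric_space"
  assumes "bounded S" and "\<not> uniformly_continuous_on S f"
  obtains \<epsilon> a b p where "\<epsilon> > 0" and "\<And>n. a n \<in> S" and "\<And>n. b n \<in> S"
    and "a \<longlonglongrightarrow> p" and "b \<longlonglongrightarrow> p" and "\<And>n. dist (f (a n)) (f (b n)) \<ge> \<epsilon>"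
proof -
  from assms(2) obtain \<epsilon> where "\<epsilon> > 0"
    and far: "\<And>d. d > 0 \<Longrightarrow> \<exists>x\<in>S. \<exists>y\<in>S. dist x y < d \<and> dist (f x) (f y) \<ge> \<epsilon>"
    unfolding uniformly_continuous_on_def by (metis dist_commute not_less)
  have "\<exists>x y. x \<in> S \<and> y \<in> S \<and> dist x y < inverse (real (Suc n)) \<and> dist (f x) (f y) \<ge> \<epsilon>"
    for n
    using far[of "inverse (real (Suc n))"] by auto
  then obtain x y where xy: "\<And>n. x n \<in> S" "\<And>n. y n \<in> S" "\<And>n. dist (f (x n)) (f (y n)) \<ge> \<epsilon>"
    and close: "\<And>n. dist (x n) (y n) < inverse (real (Suc n))"
    by metis
  have "bounded (range x)"
    using assms(1) by (rule bounded_subset) (use xy in auto)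
  then obtain p r where r: "strict_mono r" and x: "(x \<circ> r) \<longlonglongrightarrow> p"
    using bounded_imp_convergent_subsequence by blast
  have "(\<lambda>n. dist (x n) (y n)) \<longlonglongrightarrow> 0"
    by (rule tendsto_sandwich[OF _ _ tendsto_const LIMSEQ_inverse_real_of_nat])
       (auto intro!: always_eventually less_imp_le close simp del: of_nat_Suc)
  then have dist: "(\<lambda>n. dist ((x \<circ> r) n) ((y \<circ> r) n)) \<longlonglongrightarrow> 0"
    using LIMSEQ_subseq_LIMSEQ[OF _ r] by (fastforce simp: o_def)
  have y: "(y \<circ> r) \<longlonglongrightarrow> p"
  proof (rule iffD2[OF tendsto_dist_iff])
    have sum: "(\<lambda>n. dist ((x \<circ> r) n) ((y \<circ> r) n) + dist ((x \<circ> r) n) p) \<longlonglongrightarrow> 0"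
      using tendsto_add[OF dist iffD1[OF tendsto_dist_iff x]] by simp
    show "(\<lambda>n. dist ((y \<circ> r) n) p) \<longlonglongrightarrow> 0"
      by (rule tendsto_sandwich[OF _ _ tendsto_const sum])
         (auto intro!: always_eventually dist_triangle3)
  qed
  show thesis
    by (rule that[OF \<open>\<epsilon> > 0\<close> _ _ x y]) (auto simp: xy)
qed

lemma uniformly_continuous_on_if_quasi_Cauchy:
  fixes f :: "'a::{heine_borel, real_normed_vector} \<Rightarrow> 'b::real_normed_vector"
  assumes "bounded S"
    and quasi: "\<And>z. double_seq_in S z \<Longrightarrow> double_Cauchy z \<Longrightarrow> double_quasi_Cauchy (\<lambda>k l. f (z k l))"
  shows "uniformly_continuous_on S f"
proof (rule ccontr)
  assume "\<not> uniformly_continuous_on S f"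
  with \<open>bounded S\<close> obtain \<epsilon> a b p where "\<epsilon> > 0" and ab: "\<And>n. a n \<in> S" "\<And>n. b n \<in> S"
    and lim: "a \<longlonglongrightarrow> p" "b \<longlonglongrightarrow> p" and far: "\<And>n. dist (f (a n)) (f (b n)) \<ge> \<epsilon>"
    by (rule not_uniformly_continuous_on_bounded) blast
  define w where "w n = (if even n then a (n div 2) else b (n div 2))" for n
  have "w \<longlonglongrightarrow> p"
    unfolding w_def using lim by (rule LIMSEQ_interleave)
  then have "double_Cauchy (\<lambda>k l::nat. w k)"
    by (intro Cauchy_imp_double_Cauchy LIMSEQ_imp_Cauchy)
  moreover have "double_seq_in S (\<lambda>k l. w k)"
    by (simp add: double_seq_in_def w_def ab)
  ultimately have "double_quasi_Cauchy (\<lambda>k l. f (w k))"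
    by (intro quasi)
  with \<open>\<epsilon> > 0\<close> obtain N where "\<And>k l. k > N \<Longrightarrow> l > N \<Longrightarrow> norm (f (w k) - f (w (k + 1))) < \<epsilon>"
    unfolding double_quasi_Cauchy_iff by (metis insertI1 insertI2)
  from this[of "2 * Suc N" "Suc N"] have "norm (f (w (2 * Suc N)) - f (w (2 * Suc N + 1))) < \<epsilon>"
    by simp
  moreover have "w (2 * Suc N) = a (Suc N)" "w (2 * Suc N + 1) = b (Suc N)"
    by (simp_all add: w_def)
  ultimately show False
    using far[of "Suc N"] by (simp add: dist_norm)
qed

theorem theorem3p5:
  fixes I :: "real set" and f :: "real \<times> real \<Rightarrow> real"
  assumes "is_interval I" and "bounded I" and "factorable_on I f"
  shows "uniformly_continuous_on (I \<times> I) f \<longleftrightarrow>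
    (\<forall>z :: nat \<Rightarrow> nat \<Rightarrow> real \<times> real.
       double_seq_in (I \<times> I) z \<and> double_Cauchy z \<longrightarrow>
       double_quasi_Cauchy (\<lambda>k l. f (z k l)))"
proof
  assume "uniformly_continuous_on (I \<times> I) f"
  then show "\<forall>z. double_seq_in (I \<times> I) z \<and> double_Cauchy z \<longrightarrow>
      double_quasi_Cauchy (\<lambda>k l. f (z k l))"
    by (blast intro: double_Cauchy_imp_quasi_Cauchy uniformly_continuous_on_double_Cauchy)
next
  assume "\<forall>z. double_seq_in (I \<times> I) z \<and> double_Cauchy z \<longrightarrow>
      double_quasi_Cauchy (\<lambda>k l. f (z k l))"
  moreover have "bounded (I \<times> I)"
    using \<open>bounded I\<close> \<open>bounded I\<close> by (rule bounded_Times)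
  ultimately show "uniformly_continuous_on (I \<times> I) f"
    by (blast intro: uniformly_continuous_on_if_quasi_Cauchy)
qed

end
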